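(* For any integer $k\ge 2$, $$c_k\;\ge\;2(k-1)\sin\left(\frac{\pi}{k}\right)+2\sin\left(\frac{\pi}{2k}\right)\;\ge\;2\pi-\frac{\pi}{k}-\frac{\pi^3}{3k^2}+\frac{7\pi^3}{24k^3}.$$ In particular, $\lim_{k\to\infty}c_k=2\pi$.
   Context: Let $\mathcal{C}$ be the unit circle in $\mathbb{R}^2$ centered at the origin, let $R=(1,0)$, and let $d(\cdot,\cdot)$ denote Euclidean distance. For $k\in\mathbb{N}$ and $(T_1,\dots,T_k)\in\mathcal{C}^k$ define $$C(T_1,\dots,T_k)=\min_\sigma\Big(d(R,T_{\sigma(1)})+\sum_{i=2}^k d(T_{\sigma(i-1)},T_{\sigma(i)})\Big),$$ the minimum being over all permutations $\sigma$ of $\{1,\dots,k\}$, and $$c_k=\sup_{(T_1,\dots,T_k)\in\mathcal{C}^k}C(T_1,\dots,T_k).$$ *)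

theory Defs
  imports "HOL-Analysis.Analysis"
begin

definition unit_circle :: "(real^2) set" where
  "unit_circle = sphere 0 1"

definition R :: "real^2" where
  "R = vector [1, 0]"

text \<open>A tuple \<open>(T\<^sub>1, \<dots>, T\<^sub>k)\<close> is a function on indices \<open>1, \<dots>, k\<close>; the values outside
  this range are irrelevant. The definitions are meant for \<open>k \<ge> 1\<close>.\<close>

definition path_length :: "nat \<Rightarrow> (nat \<Rightarrow> real^2) \<Rightarrow> (nat \<Rightarrow> nat) \<Rightarrow> real" where
  "path_length k T \<sigma> = dist R (T (\<sigma> 1)) + (\<Sum>i=2..k. dist (T (\<sigma> (i - 1))) (T (\<sigma> i)))"

definition C :: "nat \<Rightarrow> (nat \<Rightarrow> real^2) \<Rightarrow> real" where
  "C k T = Min (path_length k T ` {\<sigma>. \<sigma> permutes {1..k}})"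

text \<open>Every path length is at most \<open>2 * k\<close>, so for \<open>k \<ge> 1\<close> this is the supremum of a nonempty
  set that is bounded above.\<close>

definition c :: "nat \<Rightarrow> real" where
  "c k = (SUP T \<in> {1..k} \<rightarrow>\<^sub>E unit_circle. C k T)"

end

theory Submission
  imports Defs "HOL-Combinatorics.Permutations" "HOL-Real_Asymp.Real_Asymp"
begin

text \<open>For the lower bound take the regular \<open>k\<close>-gon rotated so that \<open>R\<close> bisects one of its arcs:
  any two of its points are at distance at least \<open>2 sin (\<pi>/k)\<close>, and \<open>R\<close> is at distance at least
  \<open>2 sin (\<pi>/2k)\<close> from all of them, so every ordering is at least as long as claimed. The explicit
  bound is \<open>sin x \<ge> x - x\<^sup>3/6\<close>. Conversely, visiting arbitrary points in the order of
  their angles costs at most one full turn since chords are shorter than arcs; hence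
  \<open>c k \<le> 2\<pi>\<close> and the limit follows by squeezing.\<close>

definition circle_point :: "real \<Rightarrow> real^2" where
  "circle_point a = vector [cos a, sin a]"

lemma R_eq_circle_point: "R = circle_point 0"
  by (simp add: R_def circle_point_def)

lemma norm_circle_point: "norm (circle_point a) = 1"
  by (simp add: norm_vec_def L2_set_def circle_point_def sum_2)

text \<open>Law of cosines followed by the half-angle formula. The absolute value makes the identity
  valid for all real angles, without reduction modulo \<open>2 * pi\<close>.\<close>

lemma dist_circle_point: "dist (circle_point a) (circle_point b) = 2 * \<bar>sin ((a - b) / 2)\<bar>"
proof -
  have "(dist (circle_point a) (circle_point b))\<^sup>2 = (cos a - cos b)\<^sup>2 + (sin a - sin b)\<^sup>2"
    by (simp add: dist_vec_def L2_set_def circle_point_def sum_2 dist_real_def)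
  also have "\<dots> = ((sin a)\<^sup>2 + (cos a)\<^sup>2) + ((sin b)\<^sup>2 + (cos b)\<^sup>2) - 2 * cos (a - b)"
    unfolding cos_diff by (simp add: power2_eq_square algebra_simps)
  also have "\<dots> = 2 - 2 * cos (2 * ((a - b) / 2))"
    by (simp only: nonzero_mult_div_cancel_left times_divide_eq_right) simp
  also have "\<dots> = (2 * \<bar>sin ((a - b) / 2)\<bar>)\<^sup>2"
    unfolding cos_double_sin by (simp add: power_mult_distrib)
  finally show ?thesis by (rule power2_eq_imp_eq) simp_all
qed

lemma dist_circle_point_le: "dist (circle_point a) (circle_point b) \<le> \<bar>a - b\<bar>"
  using abs_sin_x_le_abs_x[of "(a - b) / 2"] by (simp add: dist_circle_point)

lemma unit_circle_angle:
  assumes "x \<in> unit_circle"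
  obtains t where "0 \<le> t" "t < 2 * pi" "x = circle_point t"
proof -
  have "(x $ 1)\<^sup>2 + (x $ 2)\<^sup>2 = 1"
    using assms by (simp add: unit_circle_def norm_vec_def L2_set_def sum_2)
  then obtain t where "0 \<le> t" "t < 2 * pi" "x $ 1 = cos t" "x $ 2 = sin t"
    using sincos_total_2pi by metis
  then show thesis
    by (intro that[of t]) (simp_all add: circle_point_def vec_eq_iff forall_2)
qed

text \<open>Sine increases up to \<open>pi / 2\<close> and is symmetric about it. Applied to half
  the angle between two points, this bounds a chord from below.\<close>

lemma sin_ge_sin_endpoint:
  fixes a x :: real
  assumes "0 \<le> a" "a \<le> x" "x \<le> pi - a"
  shows "sin a \<le> sin x"
proof (cases "x \<le> pi / 2")
  case True
  then show ?thesis using assms by (intro sin_monotone_2pi_le) auto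
next
  case False
  then have "sin a \<le> sin (pi - x)" using assms by (intro sin_monotone_2pi_le) auto
  then show ?thesis by simp
qed

text \<open>The difference of the two sides vanishes at 0, and its derivative
  \<open>cos y - 1 + y\<^sup>2 / 2\<close> is nonnegative because
  \<open>cos y = 1 - 2 * (sin (y / 2))\<^sup>2\<close>.\<close>

lemma sin_ge_cubic:
  fixes x :: real
  assumes "0 \<le> x"
  shows "x - x ^ 3 / 6 \<le> sin x"
proof -
  have cos_ge: "1 - y\<^sup>2 / 2 \<le> cos y" for y :: real
  proof -
    have "(sin (y / 2))\<^sup>2 \<le> (y / 2)\<^sup>2"
      using abs_sin_x_le_abs_x[of "y / 2"] by (simp only: abs_le_square_iff)
    then show ?thesis using cos_double_sin[of "y / 2"] by (simp add: power_divide)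
  qed
  have "(\<lambda>x. sin x - x + x ^ 3 / 6) 0 \<le> (\<lambda>x. sin x - x + x ^ 3 / 6) x"
  proof (rule DERIV_nonneg_imp_nondecreasing[OF assms])
    fix y :: real
    have "((\<lambda>x. sin x - x + x ^ 3 / 6) has_real_derivative cos y - 1 + y\<^sup>2 / 2) (at y)"
      by (auto intro!: derivative_eq_intros)
    then show "\<exists>d. ((\<lambda>x. sin x - x + x ^ 3 / 6) has_real_derivative d) (at y) \<and> 0 \<le> d"
      using cos_ge[of y] by (intro exI conjI) auto
  qed
  then show ?thesis by simp
qed

lemma ex_sorting_permutation:
  fixes \<theta> :: "nat \<Rightarrow> 'a::linorder"
  obtains \<sigma> where "\<sigma> permutes {1..k}"
    "\<And>i j. 1 \<le> i \<Longrightarrow> i \<le> j \<Longrightarrow> j \<le> k \<Longrightarrow> \<theta> (\<sigma> i) \<le> \<theta> (\<sigma> j)"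
proof -
  define xs where "xs = sort_key \<theta> [1..<Suc k]"
  \<comment> \<open>List positions start at 0 and indices at 1, hence the shift;
    \<open>permutes\<close> demands the identity outside \<open>{1..k}\<close>.\<close>
  define \<sigma> where "\<sigma> i = (if i \<in> {1..k} then xs ! (i - 1) else i)" for i
  have len: "length xs = k" and set: "set xs = {1..k}" and dist: "distinct xs"
    by (auto simp: xs_def)
  have sorted: "sorted (map \<theta> xs)" by (simp add: xs_def)
  have "bij_betw (\<lambda>i. i - 1) {1..k} {..<k}"
    by (rule bij_betwI[where g = Suc]) auto
  moreover have "bij_betw ((!) xs) {..<k} {1..k}"
    using bij_betw_nth[OF dist] len set by simp
  ultimately have "bij_betw ((!) xs \<circ> (\<lambda>i. i - 1)) {1..k} {1..k}"
    by (rule bij_betw_trans)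
  then have "bij_betw \<sigma> {1..k} {1..k}"
    by (rule bij_betw_cong[THEN iffD1, rotated]) (simp add: \<sigma>_def)
  then have "\<sigma> permutes {1..k}"
    by (rule bij_imp_permutes) (simp only: \<sigma>_def if_False)
  moreover have "\<theta> (\<sigma> i) \<le> \<theta> (\<sigma> j)" if "1 \<le> i" "i \<le> j" "j \<le> k" for i j
    using sorted_nth_mono[OF sorted, of "i - 1" "j - 1"] that len by (simp add: \<sigma>_def)
  ultimately show thesis by (rule that)
qed

lemma C_le_path_length: "\<sigma> permutes {1..k} \<Longrightarrow> C k T \<le> path_length k T \<sigma>"
  unfolding C_def by (intro Min_le) (auto simp: finite_permutations)

lemma C_geI:
  assumes "\<And>\<sigma>. \<sigma> permutes {1..k} \<Longrightarrow> L \<le> path_length k T \<sigma>"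
  shows "L \<le> C k T"
proof -
  have "{\<sigma>. \<sigma> permutes {1..k}} \<noteq> {}" using permutes_id by blast
  then show ?thesis
    unfolding C_def using assms by (subst Min_ge_iff) (auto simp: finite_permutations)
qed

lemma C_le_2pi:
  assumes "k \<ge> 1" and T: "T \<in> {1..k} \<rightarrow> unit_circle"
  shows "C k T \<le> 2 * pi"
proof -
  have "\<forall>i\<in>{1..k}. \<exists>t. 0 \<le> t \<and> t < 2 * pi \<and> T i = circle_point t"
    using T unit_circle_angle by (metis PiE)
  then obtain \<theta> where \<theta>:
    "\<And>i. i \<in> {1..k} \<Longrightarrow> 0 \<le> \<theta> i \<and> \<theta> i < 2 * pi \<and> T i = circle_point (\<theta> i)"
    by metis
  obtain \<sigma> where \<sigma>: "\<sigma> permutes {1..k}"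
    and mono: "\<And>i j. 1 \<le> i \<Longrightarrow> i \<le> j \<Longrightarrow> j \<le> k \<Longrightarrow> \<theta> (\<sigma> i) \<le> \<theta> (\<sigma> j)"
    using ex_sorting_permutation by blast
  have \<sigma>_in: "\<sigma> i \<in> {1..k}" if "i \<in> {1..k}" for i
    using permutes_in_image[OF \<sigma>] that by blast
  \<comment> \<open>\<open>R\<close> has angle 0 and all angles are nonnegative, so this first leg
    fits the same telescoping pattern as the later ones.\<close>
  have start: "dist R (T (\<sigma> 1)) \<le> \<theta> (\<sigma> 1)"
    using dist_circle_point_le[of 0 "\<theta> (\<sigma> 1)"] \<theta>[OF \<sigma>_in[of 1]] assms(1)
    by (simp add: R_eq_circle_point)
  have step: "dist (T (\<sigma> (i - 1))) (T (\<sigma> i)) \<le> \<theta> (\<sigma> i) - \<theta> (\<sigma> (i - 1))" if "i \<in> {2..k}" for i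
  proof -
    have "i \<in> {1..k}" "i - 1 \<in> {1..k}" using that by auto
    then have "T (\<sigma> (i - 1)) = circle_point (\<theta> (\<sigma> (i - 1)))" "T (\<sigma> i) = circle_point (\<theta> (\<sigma> i))"
      using \<theta> \<sigma>_in by blast+
    moreover have "\<theta> (\<sigma> (i - 1)) \<le> \<theta> (\<sigma> i)" using mono that by auto
    ultimately show ?thesis
      using dist_circle_point_le[of "\<theta> (\<sigma> (i - 1))" "\<theta> (\<sigma> i)"] by simp
  qed
  \<comment> \<open>The lower limit 2 becomes \<open>Suc 1\<close> to match the shape of
    \<open>sum_telescope''\<close>.\<close>
  have "(\<Sum>i=2..k. dist (T (\<sigma> (i - 1))) (T (\<sigma> i)))
      \<le> (\<Sum>i=Suc 1..k. \<theta> (\<sigma> i) - \<theta> (\<sigma> (i - 1)))"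
    using step by (simp only: numeral_2_eq_2 One_nat_def) (rule sum_mono)
  also have "\<dots> = \<theta> (\<sigma> k) - \<theta> (\<sigma> 1)"
    using assms(1) by (rule sum_telescope'')
  finally have "path_length k T \<sigma> \<le> \<theta> (\<sigma> k)"
    unfolding path_length_def using start by linarith
  also have "\<dots> \<le> 2 * pi" using \<theta>[OF \<sigma>_in[of k]] assms(1) by simp
  finally show ?thesis using C_le_path_length[OF \<sigma>, of T] by linarith
qed

lemma c_le_2pi:
  assumes "k \<ge> 1"
  shows "c k \<le> 2 * pi"
  unfolding c_def
proof (rule cSUP_least)
  have "R \<in> unit_circle" by (simp add: unit_circle_def R_eq_circle_point norm_circle_point)
  then show "{1..k} \<rightarrow>\<^sub>E unit_circle \<noteq> {}" by (auto simp: PiE_eq_empty_iff)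
qed (use C_le_2pi[OF assms] in auto)

text \<open>A real supremum dominates its members only if the set is bounded above;
  \<open>C_le_2pi\<close> supplies the bound.\<close>

lemma C_le_c:
  assumes "k \<ge> 1" "T \<in> {1..k} \<rightarrow>\<^sub>E unit_circle"
  shows "C k T \<le> c k"
  unfolding c_def using assms C_le_2pi[OF assms(1)]
  by (intro cSUP_upper bdd_aboveI2[where M = "2 * pi"]) auto

lemma c_ge_polygon:
  assumes "k \<ge> 1"
  shows "2 * (real k - 1) * sin (pi / real k) + 2 * sin (pi / (2 * real k)) \<le> c k"
proof -
  \<comment> \<open>Odd multiples of \<open>pi / k\<close>: neighbours are \<open>2 * pi / k\<close>
    apart, and the first and last points lie at angle \<open>pi / k\<close> on either side of
    \<open>R\<close>.\<close>
  define \<theta> where "\<theta> i = (2 * real i - 1) * pi / k" for i :: nat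
  define T where "T = restrict (\<lambda>i. circle_point (\<theta> i)) {1..k}"
  have near: "2 * sin (pi / (2 * real k)) \<le> dist R (T i)" if "i \<in> {1..k}" for i
  proof -
    have "sin (pi / (2 * real k)) \<le> sin (\<theta> i / 2)"
    proof (rule sin_ge_sin_endpoint)
      have "1 * pi \<le> (2 * real i - 1) * pi" using that by (intro mult_right_mono) auto
      then show "pi / (2 * real k) \<le> \<theta> i / 2"
        using assms by (simp add: \<theta>_def field_simps)
      have "(2 * real i - 1) * pi \<le> (2 * real k - 1) * pi" using that by (intro mult_right_mono) auto
      then show "\<theta> i / 2 \<le> pi - pi / (2 * real k)"
        using assms by (simp add: \<theta>_def field_simps)
    qed simp
    then show ?thesis using that by (simp add: T_def R_eq_circle_point dist_circle_point)
  qed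
  \<comment> \<open>For \<open>i < j\<close> the index gap is between 1 and \<open>k - 1\<close>, so
    half the angle difference lies between \<open>pi / k\<close> and \<open>pi - pi / k\<close>; the
    upper end covers the neighbours across \<open>R\<close>.\<close>
  have sep: "2 * sin (pi / real k) \<le> dist (T i) (T j)" if "i \<in> {1..k}" "j \<in> {1..k}" "i < j" for i j
  proof -
    have "sin (pi / real k) \<le> sin ((\<theta> j - \<theta> i) / 2)"
    proof (rule sin_ge_sin_endpoint)
      have eq: "(\<theta> j - \<theta> i) / 2 = (real j - real i) * pi / k"
        using assms by (simp add: \<theta>_def field_simps)
      have "1 * pi \<le> (real j - real i) * pi" using that by (intro mult_right_mono) auto
      then show "pi / real k \<le> (\<theta> j - \<theta> i) / 2"
        unfolding eq using assms by (simp add: field_simps)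
      have "(real j - real i) * pi / k \<le> (real k - 1) * pi / k"
        using that by (intro divide_right_mono mult_right_mono) auto
      also have "\<dots> = pi - pi / real k" using assms by (simp add: field_simps)
      finally show "(\<theta> j - \<theta> i) / 2 \<le> pi - pi / real k" unfolding eq .
    qed simp
    then show ?thesis
      using that by (subst dist_commute) (simp add: T_def dist_circle_point)
  qed
  have "2 * (real k - 1) * sin (pi / real k) + 2 * sin (pi / (2 * real k)) \<le> C k T"
  proof (rule C_geI)
    fix \<sigma> assume \<sigma>: "\<sigma> permutes {1..k}"
    have \<sigma>_in: "\<sigma> i \<in> {1..k}" if "i \<in> {1..k}" for i
      using permutes_in_image[OF \<sigma>] that by blast
    have "2 * sin (pi / real k) \<le> dist (T (\<sigma> (i - 1))) (T (\<sigma> i))" if "i \<in> {2..k}" for i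
    proof -
      \<comment> \<open>Consecutive stops are distinct vertices, so each of the \<open>k - 1\<close>
        legs after the first has at least the side length of the polygon.\<close>
      have "\<sigma> (i - 1) \<noteq> \<sigma> i" using inj_eq[OF permutes_inj[OF \<sigma>]] that by auto
      moreover have "\<sigma> (i - 1) \<in> {1..k}" "\<sigma> i \<in> {1..k}"
        by (rule \<sigma>_in, use that in fastforce)+
      ultimately show ?thesis using sep by (metis dist_commute linorder_neqE_nat)
    qed
    then have "(\<Sum>i=2..k. 2 * sin (pi / real k)) \<le> (\<Sum>i=2..k. dist (T (\<sigma> (i - 1))) (T (\<sigma> i)))"
      by (rule sum_mono)
    then show "2 * (real k - 1) * sin (pi / real k) + 2 * sin (pi / (2 * real k)) \<le> path_length k T \<sigma>"
      unfolding path_length_def using near[OF \<sigma>_in[of 1]] assms by (simp add: of_nat_diff algebra_simps)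
  qed
  also have "\<dots> \<le> c k"
    using assms by (rule C_le_c) (auto simp: T_def unit_circle_def norm_circle_point)
  finally show ?thesis .
qed

lemma polygon_bound_ge:
  assumes "k \<ge> 1"
  shows "2 * pi - pi / real k - pi ^ 3 / (3 * real k ^ 2) + 7 * pi ^ 3 / (24 * real k ^ 3)
    \<le> 2 * (real k - 1) * sin (pi / real k) + 2 * sin (pi / (2 * real k))"
proof -
  let ?p = "\<lambda>x::real. x - x ^ 3 / 6"
  \<comment> \<open>In terms of \<open>k\<close> and \<open>y\<close> the explicit bound is exactly
    the polygon bound with both sines replaced by \<open>?p\<close>, a polynomial identity.\<close>
  define y where "y = pi / (2 * real k)"
  have k: "real k \<noteq> 0" using assms by simp
  then have pi_eq: "pi = 2 * real k * y" by (simp add: y_def)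
  \<comment> \<open>Stated for \<open>2 * pi\<close> instead of \<open>pi\<close>, so that rewriting
    with it leaves intact the quotients handled by \<open>in_y\<close>.\<close>
  then have two_pi: "2 * pi = 4 * real k * y" by linarith
  have in_y: "pi / real k = 2 * y" "pi / (2 * real k) = y"
    "pi ^ 3 / (3 * real k ^ 2) = 8 / 3 * real k * y ^ 3"
    "7 * pi ^ 3 / (24 * real k ^ 3) = 7 / 3 * y ^ 3"
    using k by (simp_all add: pi_eq power_mult_distrib power2_eq_square power3_eq_cube)
  have "2 * pi - pi / real k - pi ^ 3 / (3 * real k ^ 2) + 7 * pi ^ 3 / (24 * real k ^ 3)
      = 2 * (real k - 1) * ?p (pi / real k) + 2 * ?p (pi / (2 * real k))"
    unfolding in_y two_pi by (simp add: power_mult_distrib field_simps)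
  also have "\<dots> \<le> 2 * (real k - 1) * sin (pi / real k) + 2 * sin (pi / (2 * real k))"
    using assms by (intro add_mono mult_left_mono sin_ge_cubic) auto
  finally show ?thesis .
qed

theorem lemma1:
  "(\<forall>k::nat. k \<ge> 2 \<longrightarrow>
      c k \<ge> 2 * (real k - 1) * sin (pi / real k) + 2 * sin (pi / (2 * real k)) \<and>
      2 * (real k - 1) * sin (pi / real k) + 2 * sin (pi / (2 * real k))
        \<ge> 2 * pi - pi / real k - pi ^ 3 / (3 * real k ^ 2) + 7 * pi ^ 3 / (24 * real k ^ 3)) \<and>
   c \<longlonglongrightarrow> 2 * pi"
proof (intro conjI allI impI)
  fix k :: nat
  assume "k \<ge> 2"
  then have "k \<ge> 1" by simp
  then show "c k \<ge> 2 * (real k - 1) * sin (pi / real k) + 2 * sin (pi / (2 * real k))"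
    and "2 * (real k - 1) * sin (pi / real k) + 2 * sin (pi / (2 * real k))
      \<ge> 2 * pi - pi / real k - pi ^ 3 / (3 * real k ^ 2) + 7 * pi ^ 3 / (24 * real k ^ 3)"
    by (rule c_ge_polygon, rule polygon_bound_ge)
next
  let ?L = "\<lambda>k. 2 * (real k - 1) * sin (pi / real k) + 2 * sin (pi / (2 * real k))"
  show "c \<longlonglongrightarrow> 2 * pi"
  proof (rule tendsto_sandwich)
    \<comment> \<open>Both bounds on \<open>c k\<close> hold from \<open>k = 1\<close> on, which is
      the threshold taken here; \<open>c 0\<close> does not affect the limit.\<close>
    show "\<forall>\<^sub>F k in sequentially. ?L k \<le> c k"
      by (rule eventually_sequentiallyI) (rule c_ge_polygon)
    show "\<forall>\<^sub>F k in sequentially. c k \<le> 2 * pi"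
      by (rule eventually_sequentiallyI) (rule c_le_2pi)
    show "?L \<longlonglongrightarrow> 2 * pi" by real_asymp
  qed (rule tendsto_const)
qed

end
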